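(* Let $K$ be a division ring and $\mathrm{k}$ a subfield contained in the center of $K$. Let $A,B,C$ be finite nonempty subsets of $K^{\ast}=K\setminus\{0\}$. Then \[(\dim_{\mathrm{k}}(ABC))^{2}\leq\dim_{\mathrm{k}}(AB)\dim_{\mathrm{k}}(BC)\max_{b\in B}\{\dim_{\mathrm{k}}(AbC)\}.\] In particular, when $K$ is a field, \[\dim_{\mathrm{k}}(ABC)^{2}\leq\dim_{\mathrm{k}}(AB)\dim_{\mathrm{k}}(BC)\dim_{\mathrm{k}}(AC).\]
   Context: For $Y\subseteq K$, $\dim_{\mathrm{k}}(Y)$ is the dimension over $\mathrm{k}$ of the $\mathrm{k}$-linear span of $Y$. Products of sets are Minkowski products, e.g. $AbC=\{abc\mid a\in A,c\in C\}$. *)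

theory Defs
  imports "HOL-Algebra.Embedded_Algebras"
begin

locale div_ring = ring +
  assumes one_not_zero: "\<one> \<noteq> \<zero>"
    and div_ring_Units: "Units R = carrier R - {\<zero>}"

definition (in ring) center :: "'a set"
  where "center = {z \<in> carrier R. \<forall>x \<in> carrier R. z \<otimes> x = x \<otimes> z}"

(* Despite its name, the library's subalgebra k V R only says that V is a k-subspace of R:
   an additive subgroup closed under multiplication by k from the left. *)
definition (in ring) lin_span :: "'a set \<Rightarrow> 'a set \<Rightarrow> 'a set"
  where "lin_span k Y = \<Inter> {V. subalgebra k V R \<and> Y \<subseteq> V}"

definition (in ring) span_dim :: "'a set \<Rightarrow> 'a set \<Rightarrow> nat"
  where "span_dim k Y = (dim over k) (lin_span k Y)"

context ring
begin

lemma lin_span_eq_Span: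
  assumes "subfield k R" and "set Us \<subseteq> carrier R"
  shows "lin_span k (set Us) = Span k Us"
proof
  show "lin_span k (set Us) \<subseteq> Span k Us"
    unfolding lin_span_def
    using Span_is_subalgebra[OF assms] Span_base_incl[OF assms] by blast
  show "Span k Us \<subseteq> lin_span k (set Us)"
    unfolding lin_span_def
  proof (rule Inter_greatest)
    fix V assume "V \<in> {V. subalgebra k V R \<and> set Us \<subseteq> V}"
    then have V: "subalgebra k V R" "set Us \<subseteq> V" by auto
    have "k <#> set Us \<subseteq> V"
      using V subalgebra.smult_closed[OF V(1)] unfolding set_mult_def by blast
    then show "Span k Us \<subseteq> V"
      by (rule Span_min[OF assms subalgebra.axioms(1)[OF V(1)]])
  qed
qed

(* On finite sets span_dim is a genuine one, not an artefact of the
   description operator in the library's dim. *)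
lemma span_dim_dimension:
  assumes "subfield k R" and "finite Y" and "Y \<subseteq> carrier R"
  shows "dimension (span_dim k Y) k (lin_span k Y)"
proof -
  obtain Us where Us: "set Us = Y"
    using finite_list[OF assms(2)] by blast
  then show ?thesis
    using finite_dimensionE[OF assms(1) Span_finite_dimension[OF assms(1)]]
      lin_span_eq_Span[OF assms(1)] assms(3)
    unfolding span_dim_def by metis
qed

end

end

theory Submission
  imports Defs
begin

text \<open>
  Add the elements of \<open>B\<close> one at a time. If passing from \<open>B\<close> to \<open>B \<union> {b}\<close> raises the dimensions of
  \<open>AB\<close>, \<open>BC\<close>, \<open>ABC\<close> by \<open>x\<close>, \<open>y\<close>, \<open>z\<close>, choose \<open>A' \<subseteq> A\<close> of size \<open>x\<close> and \<open>C' \<subseteq> C\<close> of size \<open>y\<close> such that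
  \<open>A'b\<close> and \<open>bC'\<close> are bases of the new parts. Then \<open>A'bC'\<close> spans the new part of \<open>ABC\<close>, whence
  \<open>z \<le> xy\<close>; trivially \<open>z \<le> dim AbC \<le> m\<close>, the maximum in the theorem. So \<open>z\<^sup>2 \<le> mxy\<close>, and summing
  over \<open>B\<close> with the Cauchy--Schwarz inequality gives the claim.
\<close>

section \<open>A two-term Cauchy--Schwarz inequality in the natural numbers\<close>

text \<open>After expansion only the cross terms \<open>2 * Z * z\<close> and
  \<open>m * (X * y + x * Y)\<close> remain to be compared. Multiplying the hypotheses bounds the
  square of the former by \<open>4 * m\<^sup>2 * (X * y) * (x * Y)\<close>, and the inequality of
  the arithmetic and geometric means does the rest. In this form an induction can perform the
  summation over \<open>B\<close> without square roots.\<close>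

lemma square_add_le_mult_add:
  fixes m X Y Z x y z :: nat
  assumes "Z\<^sup>2 \<le> m * X * Y" and "z\<^sup>2 \<le> m * x * y"
  shows "(Z + z)\<^sup>2 \<le> m * (X + x) * (Y + y)"
proof -
  have "(2 * Z * z)\<^sup>2 = 4 * (Z\<^sup>2 * z\<^sup>2)"
    by (simp add: power2_eq_square)
  also have "\<dots> \<le> 4 * ((m * X * Y) * (m * x * y))"
    using mult_le_mono[OF assms] by simp
  also have "\<dots> = m\<^sup>2 * (4 * (X * y) * (x * Y))"
    by (simp add: power2_eq_square)
  also have "\<dots> \<le> m\<^sup>2 * (X * y + x * Y)\<^sup>2"
  proof (rule mult_le_mono2)
    \<comment> \<open>The square of the difference is taken in the reals because subtraction of
      naturals truncates.\<close>
    have "4 * (real (X * y)) * real (x * Y) \<le> (real (X * y) + real (x * Y))\<^sup>2"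
      using zero_le_power2[of "real (X * y) - real (x * Y)"]
      by (simp add: power2_eq_square algebra_simps)
    then show "4 * (X * y) * (x * Y) \<le> (X * y + x * Y)\<^sup>2"
      by (metis (mono_tags, lifting) of_nat_add of_nat_le_iff of_nat_mult of_nat_numeral of_nat_power)
  qed
  finally have "(2 * Z * z)\<^sup>2 \<le> (m * (X * y + x * Y))\<^sup>2"
    by (simp add: power_mult_distrib)
  then have "2 * Z * z \<le> m * (X * y + x * Y)"
    by (simp only: power2_nat_le_eq_le)
  then show ?thesis
    using assms by (simp add: power2_eq_square algebra_simps)
qed

section \<open>Minkowski products of sets\<close>

lemma set_mult_Un_left: "(A \<union> B) <#>\<^bsub>G\<^esub> C = (A <#>\<^bsub>G\<^esub> C) \<union> (B <#>\<^bsub>G\<^esub> C)"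
  unfolding set_mult_def by auto

lemma set_mult_Un_right: "A <#>\<^bsub>G\<^esub> (B \<union> C) = (A <#>\<^bsub>G\<^esub> B) \<union> (A <#>\<^bsub>G\<^esub> C)"
  unfolding set_mult_def by auto

lemma finite_set_mult: "finite A \<Longrightarrow> finite B \<Longrightarrow> finite (A <#>\<^bsub>G\<^esub> B)"
  unfolding set_mult_def by auto

lemma card_set_mult_le:
  assumes "finite A" "finite B"
  shows "card (A <#>\<^bsub>G\<^esub> B) \<le> card A * card B"
proof -
  have "A <#>\<^bsub>G\<^esub> B = (\<lambda>(a, b). a \<otimes>\<^bsub>G\<^esub> b) ` (A \<times> B)"
    unfolding set_mult_def by auto
  then show ?thesis
    using assms card_image_le[of "A \<times> B" "\<lambda>(a, b). a \<otimes>\<^bsub>G\<^esub> b"] by (simp add: card_cartesian_product)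
qed

text \<open>One preimage is chosen for each element of \<open>D\<close>, which makes right
  multiplication by \<open>b\<close> injective on \<open>A'\<close>. This turns a basis picked
  inside \<open>Ab\<close> into a set of left factors of the same size.\<close>

lemma subset_set_mult_singleton_right:
  assumes "D \<subseteq> A <#>\<^bsub>G\<^esub> {b}"
  obtains A' where "A' \<subseteq> A" "D = A' <#>\<^bsub>G\<^esub> {b}" "card A' = card D"
proof -
  have eq: "X <#>\<^bsub>G\<^esub> {b} = (\<lambda>a. a \<otimes>\<^bsub>G\<^esub> b) ` X" for X
    unfolding set_mult_def by auto
  then obtain A' where "A' \<subseteq> A" "inj_on (\<lambda>a. a \<otimes>\<^bsub>G\<^esub> b) A'" "D = (\<lambda>a. a \<otimes>\<^bsub>G\<^esub> b) ` A'"
    using assms by (metis subset_image_inj)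
  then show thesis
    using that eq by (metis card_image)
qed

lemma subset_set_mult_singleton_left:
  assumes "D \<subseteq> {b} <#>\<^bsub>G\<^esub> C"
  obtains C' where "C' \<subseteq> C" "D = {b} <#>\<^bsub>G\<^esub> C'" "card C' = card D"
proof -
  have eq: "{b} <#>\<^bsub>G\<^esub> X = (\<lambda>c. b \<otimes>\<^bsub>G\<^esub> c) ` X" for X
    unfolding set_mult_def by auto
  then obtain C' where "C' \<subseteq> C" "inj_on (\<lambda>c. b \<otimes>\<^bsub>G\<^esub> c) C'" "D = (\<lambda>c. b \<otimes>\<^bsub>G\<^esub> c) ` C'"
    using assms by (metis subset_image_inj)
  then show thesis
    using that eq by (metis card_image)
qed

lemma (in monoid) set_mult_assoc_carrier:
  assumes "A \<subseteq> carrier G" "B \<subseteq> carrier G" "C \<subseteq> carrier G"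
  shows "A <#> B <#> C = A <#> (B <#> C)"
  using assms unfolding set_mult_def by (fastforce simp: subset_iff m_assoc)

section \<open>Linear spans and their behaviour under multiplication\<close>

context ring
begin

lemma lin_span_incl: "Y \<subseteq> lin_span k Y"
  unfolding lin_span_def by blast

lemma lin_span_least: "subalgebra k V R \<Longrightarrow> Y \<subseteq> V \<Longrightarrow> lin_span k Y \<subseteq> V"
  unfolding lin_span_def by blast

lemma lin_span_subset: "Y \<subseteq> lin_span k Z \<Longrightarrow> lin_span k Y \<subseteq> lin_span k Z"
  unfolding lin_span_def by blast

lemma lin_span_mono: "Y \<subseteq> Z \<Longrightarrow> lin_span k Y \<subseteq> lin_span k Z"
  unfolding lin_span_def by blast

lemma lin_span_eqI: "Y \<subseteq> lin_span k Z \<Longrightarrow> Z \<subseteq> lin_span k Y \<Longrightarrow> lin_span k Y = lin_span k Z"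
  by (simp add: lin_span_subset subset_antisym)

text \<open>Scalars act from the left, so associativity carries them past the factor
  \<open>c\<close> on the right.\<close>

lemma subalgebra_vimage_mult_right:
  assumes "k \<subseteq> carrier R" "subalgebra k V R" "c \<in> carrier R"
  shows "subalgebra k {u \<in> carrier R. u \<otimes> c \<in> V} R"
proof -
  interpret V: subalgebra k V R by fact
  show ?thesis
    using assms(1,3) V.one_closed V.m_closed V.m_inv_closed V.smult_closed
    by unfold_locales (auto simp: l_distr l_minus m_assoc subset_iff simp flip: a_inv_def)
qed

text \<open>Here a scalar stands between \<open>a\<close> and \<open>u\<close>; centrality of
  \<open>k\<close> moves it to the front.\<close>

lemma subalgebra_vimage_mult_left:
  assumes "k \<subseteq> center" "subalgebra k V R" "a \<in> carrier R"
  shows "subalgebra k {u \<in> carrier R. a \<otimes> u \<in> V} R"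
proof -
  interpret V: subalgebra k V R by fact
  have "a \<otimes> (l \<otimes> u) = l \<otimes> (a \<otimes> u)" "l \<in> carrier R" if "l \<in> k" "u \<in> carrier R" for l u
    using assms(1,3) that unfolding center_def by (auto simp: subset_iff simp flip: m_assoc)
  then show ?thesis
    using assms(3) V.one_closed V.m_closed V.m_inv_closed V.smult_closed
    by unfold_locales (auto simp: r_distr r_minus simp flip: a_inv_def)
qed

context
  fixes k
  assumes k: "subfield k R"
begin

lemma lin_span_is_subalgebra:
  assumes "finite Y" "Y \<subseteq> carrier R"
  shows "subalgebra k (lin_span k Y) R"
  using finite_list[OF assms(1)] lin_span_eq_Span[OF k] Span_is_subalgebra[OF k] assms(2) by metis

text \<open>The elements that \<open>c\<close> multiplies into the target span form a subspace, so
  it is enough to test the generators \<open>Y\<close>.\<close>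

lemma lin_span_mult_right:
  assumes "finite Z" "Z \<subseteq> carrier R" "c \<in> carrier R" "Y \<subseteq> carrier R"
    and "Y <#> {c} \<subseteq> lin_span k Z" and "u \<in> lin_span k Y"
  shows "u \<otimes> c \<in> lin_span k Z"
proof -
  have "subalgebra k {u \<in> carrier R. u \<otimes> c \<in> lin_span k Z} R"
    using subfieldE(3)[OF k] assms
    by (intro subalgebra_vimage_mult_right lin_span_is_subalgebra)
  moreover have "Y \<subseteq> {u \<in> carrier R. u \<otimes> c \<in> lin_span k Z}"
    using assms unfolding set_mult_def by auto
  ultimately show ?thesis
    using lin_span_least assms(6) by blast
qed

lemma lin_span_mult_left:
  assumes "k \<subseteq> center"
    and "finite Z" "Z \<subseteq> carrier R" "a \<in> carrier R" "Y \<subseteq> carrier R"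
    and "{a} <#> Y \<subseteq> lin_span k Z" and "u \<in> lin_span k Y"
  shows "a \<otimes> u \<in> lin_span k Z"
proof -
  have "subalgebra k {u \<in> carrier R. a \<otimes> u \<in> lin_span k Z} R"
    using assms by (intro subalgebra_vimage_mult_left lin_span_is_subalgebra)
  moreover have "Y \<subseteq> {u \<in> carrier R. a \<otimes> u \<in> lin_span k Z}"
    using assms unfolding set_mult_def by auto
  ultimately show ?thesis
    using lin_span_least assms(7) by blast
qed

section \<open>Dimensions of spans of finite sets\<close>

lemma span_dim_eqI: "finite Y \<Longrightarrow> Y \<subseteq> carrier R \<Longrightarrow> dimension n k (lin_span k Y) \<Longrightarrow> span_dim k Y = n"
  using dimension_is_inj[OF k] span_dim_dimension[OF k] by blast

lemma span_dim_empty: "span_dim k {} = 0"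
proof (rule span_dim_eqI)
  show "dimension 0 k (lin_span k {})"
    using lin_span_eq_Span[OF k, of "[]"] by simp
qed auto

lemma span_dim_insert:
  assumes "finite Y" "Y \<subseteq> carrier R" "v \<in> carrier R" "v \<notin> lin_span k Y"
  shows "span_dim k (insert v Y) = Suc (span_dim k Y)"
proof (rule span_dim_eqI)
  obtain Us where Us: "set Us = Y"
    using finite_list[OF assms(1)] by blast
  have "lin_span k (insert v Y) = line_extension k v (lin_span k Y)"
    using lin_span_eq_Span[OF k, of "v # Us"] lin_span_eq_Span[OF k, of Us] Us assms by simp
  then show "dimension (Suc (span_dim k Y)) k (lin_span k (insert v Y))"
    using Suc_dim[OF assms(3,4) span_dim_dimension[OF k assms(1,2)]] by simp
qed (use assms in auto)

text \<open>Greedy choice: run through \<open>Y\<close> and keep an element only if it lies outside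
  the span reached so far; each one kept raises the dimension by one. So \<open>D\<close> is a basis
  of the span of \<open>X \<union> Y\<close> modulo that of \<open>X\<close>, consisting of elements
  of \<open>Y\<close> itself. With \<open>X = {}\<close> it is a basis of the span of
  \<open>Y\<close>.\<close>

lemma relative_basis:
  assumes "finite X" "X \<subseteq> carrier R" "finite Y" "Y \<subseteq> carrier R"
  obtains D where "D \<subseteq> Y" "Y \<subseteq> lin_span k (X \<union> D)" "span_dim k (X \<union> Y) = span_dim k X + card D"
proof -
  have "\<exists>D \<subseteq> Y. Y \<subseteq> lin_span k (X \<union> D) \<and> span_dim k (X \<union> D) = span_dim k X + card D"
    using assms(3,4)
  proof (induction Y rule: finite_induct)
    case empty
    then show ?case by simp
  next
    case (insert y Y)
    then obtain D where D: "D \<subseteq> Y" "Y \<subseteq> lin_span k (X \<union> D)"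
      "span_dim k (X \<union> D) = span_dim k X + card D" by auto
    show ?case
    proof (cases "y \<in> lin_span k (X \<union> D)")
      case True
      then show ?thesis using D by blast
    next
      case False
      have "finite D" "y \<notin> D"
        using D(1) insert.hyps finite_subset by auto
      moreover have "span_dim k (insert y (X \<union> D)) = Suc (span_dim k (X \<union> D))"
        using False D(1) insert.prems assms \<open>finite D\<close> by (intro span_dim_insert) auto
      moreover have "insert y Y \<subseteq> lin_span k (X \<union> insert y D)"
        using D(2) lin_span_incl[of "X \<union> insert y D" k] lin_span_mono[of "X \<union> D" "X \<union> insert y D" k]
        by auto
      ultimately show ?thesis
        using D by (intro exI[of _ "insert y D"]) auto
    qed
  qed
  then obtain D where D: "D \<subseteq> Y" "Y \<subseteq> lin_span k (X \<union> D)"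
    "span_dim k (X \<union> D) = span_dim k X + card D" by blast
  have "lin_span k (X \<union> Y) = lin_span k (X \<union> D)"
    using D lin_span_incl[of "X \<union> D" k] lin_span_incl[of "X \<union> Y" k] by (intro lin_span_eqI) auto
  then show thesis
    using that D unfolding span_dim_def by simp
qed

text \<open>\<open>Y \<union> Z\<close> has the same span as \<open>Z\<close>, and its dimension is
  that of \<open>Y\<close> plus the size of a relative basis.\<close>

lemma span_dim_mono:
  assumes "finite Y" "finite Z" "Z \<subseteq> carrier R" "Y \<subseteq> carrier R" "Y \<subseteq> lin_span k Z"
  shows "span_dim k Y \<le> span_dim k Z"
proof -
  obtain D where "D \<subseteq> Z" "span_dim k (Y \<union> Z) = span_dim k Y + card D"
    by (rule relative_basis[OF assms(1,4,2,3)])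
  moreover have "lin_span k (Y \<union> Z) = lin_span k Z"
    using assms lin_span_incl[of Z k] lin_span_incl[of "Y \<union> Z" k] by (intro lin_span_eqI) auto
  ultimately show ?thesis
    unfolding span_dim_def by simp
qed

lemma span_dim_Un_le_card:
  assumes "finite X" "X \<subseteq> carrier R" "finite Y" "Y \<subseteq> carrier R"
  shows "span_dim k (X \<union> Y) \<le> span_dim k X + card Y"
  using relative_basis[OF assms] card_mono[OF assms(3)] by (metis add_left_mono)

text \<open>Replace \<open>Y\<close> by a basis \<open>D\<close> of its span and count the elements
  of \<open>D\<close>.\<close>

lemma span_dim_Un_le:
  assumes "finite X" "X \<subseteq> carrier R" "finite Y" "Y \<subseteq> carrier R"
  shows "span_dim k (X \<union> Y) \<le> span_dim k X + span_dim k Y"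
proof -
  obtain D where D: "D \<subseteq> Y" "Y \<subseteq> lin_span k ({} \<union> D)" "span_dim k ({} \<union> Y) = span_dim k {} + card D"
    using relative_basis[of "{}" Y] assms by auto
  have "finite D" using D(1) assms(3) finite_subset by blast
  have "X \<union> Y \<subseteq> lin_span k (X \<union> D)"
    using D(2) lin_span_incl[of "X \<union> D" k] lin_span_mono[of D "X \<union> D" k] by auto
  then have "span_dim k (X \<union> Y) \<le> span_dim k (X \<union> D)"
    using assms D(1) \<open>finite D\<close> by (intro span_dim_mono) auto
  also have "\<dots> \<le> span_dim k X + card D"
    using assms D(1) \<open>finite D\<close> by (intro span_dim_Un_le_card) auto
  finally show ?thesis
    using D(3) span_dim_empty by simp
qed

context
  assumes center: "k \<subseteq> center"
begin

text \<open>Multiplying a basis of the span of \<open>Y\<close> by \<open>b\<close> gives a spanning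
  set with no more elements. This serves the commutative case, where
  \<open>AbC = bAC\<close>.\<close>

lemma span_dim_mult_left_le:
  assumes "finite Y" "Y \<subseteq> carrier R" "b \<in> carrier R"
  shows "span_dim k ({b} <#> Y) \<le> span_dim k Y"
proof -
  obtain D where D: "D \<subseteq> Y" "Y \<subseteq> lin_span k ({} \<union> D)" "span_dim k ({} \<union> Y) = span_dim k {} + card D"
    using relative_basis[of "{}" Y] assms by auto
  have D': "finite D" "D \<subseteq> carrier R"
    using D(1) assms finite_subset by auto
  have fin: "finite ({b} <#> D)" "finite ({b} <#> Y)"
    using D'(1) assms(1) by (simp_all add: finite_set_mult)
  have sub: "{b} <#> D \<subseteq> carrier R" "{b} <#> Y \<subseteq> carrier R"
    using D'(2) assms by (simp_all add: set_mult_closed)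
  have "b \<otimes> u \<in> lin_span k ({b} <#> D)" if "u \<in> Y" for u
    using lin_span_mult_left[OF center fin(1) sub(1) assms(3) D'(2) lin_span_incl] that D(2) by auto
  then have "span_dim k ({b} <#> Y) \<le> span_dim k ({b} <#> D)"
    using fin sub by (intro span_dim_mono) (auto simp: set_mult_def)
  also have "\<dots> \<le> card ({b} <#> D)"
    using span_dim_Un_le_card[of "{}" "{b} <#> D"] fin sub span_dim_empty by simp
  also have "\<dots> \<le> card D"
    using card_set_mult_le[of "{b}" D R] D'(1) by simp
  finally show ?thesis
    using D(3) span_dim_empty by simp
qed

section \<open>Dimension growth when one element joins the middle factor\<close>

text \<open>That \<open>A'bC'\<close> spans \<open>AbC\<close> modulo the span of \<open>ABC\<close>
  is shown in two reductions: first the right factor is brought from \<open>C\<close> into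
  \<open>C'\<close>, with the left one already in \<open>A'\<close>, then the left factor from
  \<open>A\<close> into \<open>A'\<close>. The increments \<open>x\<close> and \<open>y\<close> are
  exact, while \<open>z\<close> only bounds the growth of \<open>ABC\<close> from above.\<close>

lemma span_dim_set_mult_insert:
  assumes fin: "finite A" "finite B" "finite C"
    and sub: "A \<subseteq> carrier R" "B \<subseteq> carrier R" "C \<subseteq> carrier R" and b: "b \<in> carrier R"
  obtains x y z where
    "span_dim k (A <#> insert b B) = span_dim k (A <#> B) + x"
    "span_dim k (insert b B <#> C) = span_dim k (B <#> C) + y"
    "span_dim k (A <#> insert b B <#> C) \<le> span_dim k (A <#> B <#> C) + z"
    "z \<le> x * y" "z \<le> span_dim k (A <#> {b} <#> C)"
proof -
  obtain D where D: "D \<subseteq> A <#> {b}" "A <#> {b} \<subseteq> lin_span k ((A <#> B) \<union> D)"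
    "span_dim k ((A <#> B) \<union> (A <#> {b})) = span_dim k (A <#> B) + card D"
    by (rule relative_basis[of "A <#> B" "A <#> {b}"]) (simp_all add: assms finite_set_mult set_mult_closed)
  obtain A' where A': "A' \<subseteq> A" "D = A' <#> {b}" "card A' = card D"
    using subset_set_mult_singleton_right[OF D(1)] .
  obtain E where E: "E \<subseteq> {b} <#> C" "{b} <#> C \<subseteq> lin_span k ((B <#> C) \<union> E)"
    "span_dim k ((B <#> C) \<union> ({b} <#> C)) = span_dim k (B <#> C) + card E"
    by (rule relative_basis[of "B <#> C" "{b} <#> C"]) (simp_all add: assms finite_set_mult set_mult_closed)
  obtain C' where C': "C' \<subseteq> C" "E = {b} <#> C'" "card C' = card E"
    using subset_set_mult_singleton_left[OF E(1)] .
  have fin': "finite A'" "finite C'"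
    using A'(1) C'(1) fin finite_subset by auto
  have sub': "A' \<subseteq> carrier R" "C' \<subseteq> carrier R"
    using A'(1) C'(1) sub by auto
  define Z where "Z = A <#> B <#> C"
  define P where "P = A' <#> {b} <#> C'"
  define Q where "Q = A <#> {b} <#> C"
  have finZ: "finite Z" "finite P" "finite Q"
    unfolding Z_def P_def Q_def using fin fin' by (simp_all add: finite_set_mult)
  have subZ: "Z \<subseteq> carrier R" "P \<subseteq> carrier R" "Q \<subseteq> carrier R"
    unfolding Z_def P_def Q_def using sub sub' b by (simp_all add: set_mult_closed)
  have ZP: "finite (Z \<union> P)" "Z \<union> P \<subseteq> carrier R"
    using finZ subZ by auto
  have BE: "(B <#> C) \<union> E \<subseteq> carrier R" and AD: "(A <#> B) \<union> D \<subseteq> carrier R"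
    using A'(2) C'(2) sub sub' b by (auto simp: set_mult_def subset_iff)
  \<comment> \<open>\<open>bc\<close> is a combination of elements of \<open>BC\<close> and
    \<open>bC'\<close>; multiplying by \<open>a\<close> from \<open>A'\<close> on the left leads
    into \<open>ABC\<close> and \<open>A'bC'\<close>.\<close>
  have left: "a \<otimes> (b \<otimes> c) \<in> lin_span k (Z \<union> P)" if "a \<in> A'" "c \<in> C" for a c
  proof (rule lin_span_mult_left[OF center ZP])
    show "a \<in> carrier R" using that sub' by auto
    show "(B <#> C) \<union> E \<subseteq> carrier R" by (fact BE)
    show "b \<otimes> c \<in> lin_span k ((B <#> C) \<union> E)"
      using E(2) that unfolding set_mult_def by auto
    have "{a} <#> ((B <#> C) \<union> E) \<subseteq> (A <#> (B <#> C)) \<union> (A' <#> ({b} <#> C'))"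
      using that A'(1) C'(2) unfolding set_mult_def by blast
    also have "\<dots> = Z \<union> P"
      unfolding Z_def P_def using sub sub' b by (simp add: set_mult_assoc_carrier)
    finally show "{a} <#> ((B <#> C) \<union> E) \<subseteq> lin_span k (Z \<union> P)"
      using lin_span_incl by blast
  qed
  \<comment> \<open>Now \<open>a\<close> is arbitrary in \<open>A\<close>: \<open>ab\<close> is a
    combination of elements of \<open>AB\<close> and \<open>A'b\<close>, and multiplying by
    \<open>c\<close> on the right leads into \<open>ABC\<close> or to products \<open>a'bc\<close>,
    which \<open>left\<close> covers.\<close>
  have right: "a \<otimes> b \<otimes> c \<in> lin_span k (Z \<union> P)" if "a \<in> A" "c \<in> C" for a c
  proof (rule lin_span_mult_right[OF ZP])
    show "c \<in> carrier R" using that sub by auto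
    show "(A <#> B) \<union> D \<subseteq> carrier R" by (fact AD)
    show "a \<otimes> b \<in> lin_span k ((A <#> B) \<union> D)"
      using D(2) that unfolding set_mult_def by auto
    have "A <#> B <#> {c} \<subseteq> Z"
      unfolding Z_def using that by (intro mono_set_mult) auto
    moreover have "D <#> {c} \<subseteq> lin_span k (Z \<union> P)"
    proof
      fix w assume "w \<in> D <#> {c}"
      then obtain a' where a': "a' \<in> A'" "w = a' \<otimes> b \<otimes> c"
        unfolding A'(2) set_mult_def by auto
      then have "w = a' \<otimes> (b \<otimes> c)"
        using sub' sub b that by (auto simp: m_assoc subset_iff)
      then show "w \<in> lin_span k (Z \<union> P)"
        using left a'(1) that by simp
    qed
    ultimately show "((A <#> B) \<union> D) <#> {c} \<subseteq> lin_span k (Z \<union> P)"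
      using lin_span_incl[of "Z \<union> P" k] by (auto simp: set_mult_Un_left)
  qed
  have "Q \<subseteq> lin_span k (Z \<union> P)"
    using right unfolding Q_def set_mult_def by auto
  then have "Z \<union> Q \<subseteq> lin_span k (Z \<union> P)"
    using lin_span_incl[of "Z \<union> P" k] by auto
  then have "span_dim k (Z \<union> Q) \<le> span_dim k (Z \<union> P)"
    using finZ subZ by (intro span_dim_mono) auto
  also have "\<dots> \<le> span_dim k Z + card P"
    using finZ subZ by (intro span_dim_Un_le_card)
  also have "card P \<le> card D * card E"
    using card_set_mult_le[of "A' <#> {b}" C' R] A' C' fin'
    by (simp add: P_def finite_set_mult)
  finally have le1: "span_dim k (Z \<union> Q) \<le> span_dim k Z + card D * card E"
    by simp
  have le2: "span_dim k (Z \<union> Q) \<le> span_dim k Z + span_dim k Q"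
    using finZ subZ by (intro span_dim_Un_le)
  have AbB: "A <#> insert b B = (A <#> B) \<union> (A <#> {b})"
    and BbC: "insert b B <#> C = (B <#> C) \<union> ({b} <#> C)"
    using set_mult_Un_right[of R A B "{b}"] set_mult_Un_left[of R B "{b}" C] by simp_all
  show thesis
  \<comment> \<open>The growth of \<open>ABC\<close> obeys both bounds \<open>le1\<close> and
    \<open>le2\<close>, so their minimum serves as \<open>z\<close>.\<close>
  proof (rule that[of "card D" "card E" "min (card D * card E) (span_dim k Q)"])
    show "span_dim k (A <#> insert b B <#> C)
        \<le> span_dim k (A <#> B <#> C) + min (card D * card E) (span_dim k Q)"
      using le1 le2 by (simp add: AbB set_mult_Un_left Z_def Q_def)
  qed (use D(3) E(3) in \<open>simp_all add: AbB BbC Q_def\<close>)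
qed

section \<open>Summation over the middle factor and the final estimates\<close>

text \<open>A fixed bound \<open>m\<close> replaces the maximum over \<open>B\<close>, so that it
  stays the same while \<open>B\<close> grows in the induction. It also allows two choices later:
  the maximum itself, and the dimension of \<open>AC\<close> in the commutative case.\<close>

lemma span_dim_triple_product:
  assumes "finite A" "finite B" "finite C"
    and "A \<subseteq> carrier R" "B \<subseteq> carrier R" "C \<subseteq> carrier R"
    and "\<And>b. b \<in> B \<Longrightarrow> span_dim k (A <#> {b} <#> C) \<le> m"
  shows "(span_dim k (A <#> B <#> C))\<^sup>2 \<le> m * span_dim k (A <#> B) * span_dim k (B <#> C)"
  using assms(2,5,7)
proof (induction B rule: finite_induct)
  case empty
  have "A <#> {} <#> C = {}" unfolding set_mult_def by simp
  then show ?case by (simp add: span_dim_empty)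
next
  case (insert b B)
  obtain x y z where xyz:
    "span_dim k (A <#> insert b B) = span_dim k (A <#> B) + x"
    "span_dim k (insert b B <#> C) = span_dim k (B <#> C) + y"
    "span_dim k (A <#> insert b B <#> C) \<le> span_dim k (A <#> B <#> C) + z"
    "z \<le> x * y" "z \<le> span_dim k (A <#> {b} <#> C)"
    by (rule span_dim_set_mult_insert[of A B C b]) (use assms insert.hyps insert.prems in auto)
  have "z \<le> m" using xyz(5) insert.prems(2)[of b] by simp
  then have "z\<^sup>2 \<le> m * x * y"
    using mult_le_mono[OF _ xyz(4)] by (simp add: power2_eq_square mult.assoc)
  moreover have "(span_dim k (A <#> B <#> C))\<^sup>2 \<le> m * span_dim k (A <#> B) * span_dim k (B <#> C)"
    using insert by auto
  ultimately have "(span_dim k (A <#> B <#> C) + z)\<^sup>2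
      \<le> m * (span_dim k (A <#> B) + x) * (span_dim k (B <#> C) + y)"
    by (intro square_add_le_mult_add)
  then show ?case
    unfolding xyz(1,2) using power_mono[OF xyz(3), of 2] by linarith
qed

end

end

end

theorem theorem3p5:
  fixes K (structure) and k A B C :: "'a set"
  assumes "div_ring K"
    and "subfield k K" and "k \<subseteq> ring.center K"
    and "finite A" and "A \<noteq> {}" and "A \<subseteq> carrier K - {\<zero>}"
    and "finite B" and "B \<noteq> {}" and "B \<subseteq> carrier K - {\<zero>}"
    and "finite C" and "C \<noteq> {}" and "C \<subseteq> carrier K - {\<zero>}"
  shows "(ring.span_dim K k (A <#> B <#> C))\<^sup>2
           \<le> ring.span_dim K k (A <#> B) * ring.span_dim K k (B <#> C)
               * Max ((\<lambda>b. ring.span_dim K k (A <#> {b} <#> C)) ` B)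
       \<and> (field K \<longrightarrow>
           (ring.span_dim K k (A <#> B <#> C))\<^sup>2
             \<le> ring.span_dim K k (A <#> B) * ring.span_dim K k (B <#> C)
                 * ring.span_dim K k (A <#> C))"
proof -
  interpret ring K
    using assms(1) by (rule div_ring.axioms)
  have sub: "A \<subseteq> carrier K" "B \<subseteq> carrier K" "C \<subseteq> carrier K"
    using assms(6,9,12) by auto
  note bound = span_dim_triple_product[OF assms(2,3,4,7,10) sub]
  have "(span_dim k (A <#> B <#> C))\<^sup>2
      \<le> Max ((\<lambda>b. span_dim k (A <#> {b} <#> C)) ` B) * span_dim k (A <#> B) * span_dim k (B <#> C)"
    using assms(7) by (intro bound) auto
  moreover have "(span_dim k (A <#> B <#> C))\<^sup>2
      \<le> span_dim k (A <#> C) * span_dim k (A <#> B) * span_dim k (B <#> C)" if "field K"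
  proof (rule bound)
    interpret field K by fact
    fix b assume "b \<in> B"
    then have b: "b \<in> carrier K" using sub by auto
    \<comment> \<open>Commutativity brings \<open>b\<close> to the front, and left multiplication by
      \<open>b\<close> does not raise the dimension of \<open>AC\<close>; hence
      \<open>m = span_dim k (A <#> C)\<close> is admissible.\<close>
    have "A <#> {b} = {b} <#> A"
      using b sub(1) by (auto simp: set_mult_def m_comm subset_iff)
    then have "A <#> {b} <#> C = {b} <#> (A <#> C)"
      using b sub by (simp add: set_mult_assoc_carrier)
    then show "span_dim k (A <#> {b} <#> C) \<le> span_dim k (A <#> C)"
      using span_dim_mult_left_le[OF assms(2,3) _ _ b, of "A <#> C"] assms(4,10) sub
      by (simp add: finite_set_mult set_mult_closed)
  qed
  ultimately show ?thesis
    by (simp add: mult_ac)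
qed

end
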